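(* Let $q$ be an odd prime power, $d\ge 3$, $E\subset \mathbb F_q^d$ nonempty, $\lambda \in \{1,-1\}$, and $0<N<q$ a real number. Then $$|\mathcal{T}_1(X_\pi, E, N)| \le \begin{cases} \dfrac{Nq^{d-1}}{(q-N)|E|} + \dfrac{Nq^{\frac{d}{2}}}{q-N} ,& \text{if } d \ge 4 \text{ is even},\\[8pt] \dfrac{Nq^{d-1}}{(q-N)|E|} + \dfrac{Nq^{\frac{d-1}{2}}}{q-N} ,& \text{if } d \equiv 3 \pmod{4} \text{ and } q\equiv 3 \pmod 4,\\[8pt] \dfrac{Nq^{d-1}}{(q-N)|E|} + \dfrac{Nq^{\frac{d+1}{2}}}{q-N} , & \text{otherwise}. \end{cases}$$
   Context: $\mathbb F_q$ is the finite field with $q$ elements. For $\mathbf x\in\mathbb F_q^d$, $\|\mathbf x\|=x_1^2+\cdots+x_d^2$, and $\mathbf x\cdot\mathbf y=\sum_i x_iy_i$. $S^{d-1}=\{\mathbf x\in\mathbb F_q^d:\|\mathbf x\|=1\}$, $\pi=\{\mathbf x\in\mathbb F_q^d: x_d=\lambda\}$. $X_\pi$ is the set of lines through the origin (one-dimensional linear subspaces of $\mathbb F_q^d$) that contain a nonzero element of $\pi\cap S^{d-1}$. For a linear subspace $V$, $V^\perp=\{\mathbf x\in\mathbb F_q^d:\mathbf x\cdot\mathbf y=0\ \forall \mathbf y\in V\}$, and $\pi_V(E)=\{\mathbf x+V^\perp:\mathbf x\in\mathbb F_q^d,\ (\mathbf x+V^\perp)\cap E\neq\emptyset\}$, a set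 of cosets. $\mathcal T_1(X_\pi,E,N)=\{V\in X_\pi: |\pi_V(E)|\le N\}$. *)

theory Defs
  imports "HOL-Analysis.Analysis"
begin

text \<open>
  A finite field with \<open>q\<close> elements is a type \<open>'a::{field,finite}\<close>, with \<open>q = CARD('a)\<close>, and
  \<open>\<bbbF>\<^sub>q\<^sup>d\<close> is \<open>'a ^ 'n\<close>, with \<open>d = CARD('n)\<close>. The order on the index type serves only to single
  out the last coordinate. The dot product is the library's \<open>scalar_product\<close>; the library
  operations \<open>norm\<close>, \<open>sphere\<close> and \<open>orthogonal_comp\<close> are confined to real spaces.
\<close>

definition sq_norm :: "'a::field ^ 'n \<Rightarrow> 'a"
  where "sq_norm x = (\<Sum>i\<in>UNIV. (x $ i)\<^sup>2)"

definition unit_sphere :: "('a::field ^ 'n) set"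
  where "unit_sphere = {x. sq_norm x = 1}"

definition last_coord_plane :: "'a \<Rightarrow> ('a::field ^ 'n::{finite,linorder}) set"
  where "last_coord_plane c = {x. x $ Max UNIV = c}"

definition lines_through_sphere_section :: "('a::field ^ 'n) set \<Rightarrow> ('a ^ 'n) set set"
  where "lines_through_sphere_section P =
    {V. vec.subspace V \<and> vec.dim V = 1 \<and> (\<exists>x\<in>V. x \<noteq> 0 \<and> x \<in> P \<inter> unit_sphere)}"

definition perp :: "('a::field ^ 'n) set \<Rightarrow> ('a ^ 'n) set"
  where "perp V = {x. \<forall>y\<in>V. scalar_product x y = 0}"

definition projection_cosets :: "('a::field ^ 'n) set \<Rightarrow> ('a ^ 'n) set \<Rightarrow> ('a ^ 'n) set set"
  where "projection_cosets V E = {(+) x ` perp V | x. (+) x ` perp V \<inter> E \<noteq> {}}"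

definition exceptional_lines ::
    "('a::field ^ 'n) set set \<Rightarrow> ('a ^ 'n) set \<Rightarrow> real \<Rightarrow> ('a ^ 'n) set set"
  where "exceptional_lines X E N = {V \<in> X. real (card (projection_cosets V E)) \<le> N}"

end

(*
Each line in X_pi is spanned by exactly one point x with last coordinate c = +-1, and then the other
coordinates lie on the cone x_1^2 + ... + x_{d-1}^2 = 0; its projection of E has as many elements as
{z . x | z in E}. If that number is at most N, Cauchy-Schwarz yields at least |E|^2 / N collisions
z . x = w . x, while for every x it yields at least |E|^2 / q. Hence the excess of collisions summed over
all x is at least |T| |E|^2 (1/N - 1/q). Exchanging summations, q times that excess is the sum over
z, w in E of discrepancy (z - w), where the discrepancy of u measures how far the number of x
orthogonal to u is from its average. Completing the square evaluates the discrepancy by Gauss sums: it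
is at most q^(d-1) at u = 0, plus an error governed by the parity of d - 1 and by the sign of the
(d-1)-th power of the Gauss sum.
*)
theory Submission
  imports Defs
begin

section \<open>Additive and quadratic characters\<close>

text \<open>The usual construction composes the field trace with the exponential. Here projection
  onto the prime field along an additive complement replaces the trace.\<close>

lemma additive_character_exists:
  "\<exists>\<psi>::'a::{field,finite} \<Rightarrow> complex.
     \<psi> 0 = 1 \<and> (\<forall>x y. \<psi> (x + y) = \<psi> x * \<psi> y) \<and> (\<exists>x. \<psi> x \<noteq> 1)"
proof -
  define p where "p = int CHAR('a)"
  have "CHAR('a) > 0"
    by (rule finite_imp_CHAR_pos) simp
  then have "prime CHAR('a)"
    by (rule prime_CHAR_semidom)
  then have p: "prime p"
    by (simp add: p_def)
  have of_int_0: "of_int k = (0::'a) \<longleftrightarrow> p dvd k" for k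
    by (simp add: p_def of_int_eq_0_iff_char_dvd)
  \<comment> \<open>A maximal additive subgroup avoiding 1 is a complement of the prime field, so the
    prime field component of \<open>x\<close> is an additive map to the integers modulo \<open>p\<close>.\<close>
  define \<H> where "\<H> = {H::'a set. 0 \<in> H \<and> 1 \<notin> H \<and> (\<forall>x\<in>H. \<forall>y\<in>H. x - y \<in> H)}"
  have "{0} \<in> \<H>"
    by (simp add: \<H>_def)
  then obtain H where H: "H \<in> \<H>" and max: "\<And>H'. H' \<in> \<H> \<Longrightarrow> H \<subseteq> H' \<Longrightarrow> H' = H"
    using finite_has_maximal[of \<H>] by (metis empty_iff finite)
  have H0: "0 \<in> H" and H1: "1 \<notin> H" and Hdiff: "\<And>x y. x \<in> H \<Longrightarrow> y \<in> H \<Longrightarrow> x - y \<in> H"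
    using H by (auto simp: \<H>_def)
  have Hneg: "- x \<in> H" if "x \<in> H" for x
    using Hdiff[OF H0 that] by simp
  have Hadd: "x + y \<in> H" if "x \<in> H" "y \<in> H" for x y
    using Hdiff[OF that(1) Hneg[OF that(2)]] by simp
  have Hnat: "of_nat k * x \<in> H" if "x \<in> H" for x k
    by (induction k) (use H0 Hadd that in \<open>auto simp: distrib_right\<close>)
  have Hint: "of_int k * x \<in> H" if "x \<in> H" for x k
    using Hnat[OF that, of "nat k"] Hneg[OF Hnat[OF that, of "nat (- k)"]]
    by (cases "k \<ge> 0") auto
  have inverse_mod: "\<exists>l. of_int l * of_int k = (1::'a)" if "\<not> p dvd k" for k
  proof -
    have "coprime k p"
      using p that by (metis coprime_commute prime_imp_coprime)
    then obtain l m where "l * k + m * p = 1"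
      using bezout_int[of k p] by auto
    then have "l * k - 1 = p * (- m)"
      by (simp add: algebra_simps)
    then have "p dvd l * k - 1"
      by simp
    then have "of_int (l * k - 1) = (0::'a)"
      using of_int_0 by blast
    then have "of_int l * of_int k = (1::'a)"
      by simp
    then show ?thesis ..
  qed
  have int_in_H: "p dvd k" if "of_int k \<in> H" for k
  proof (rule ccontr)
    assume "\<not> p dvd k"
    then obtain l where "of_int l * of_int k = (1::'a)"
      using inverse_mod by blast
    then show False
      using Hint[OF that, of l] H1 by simp
  qed
  have "\<exists>k. x - of_int k \<in> H" for x
  proof (cases "x \<in> H")
    case True
    then show ?thesis
      by (intro exI[of _ 0]) simp
  next
    case False
    define H' where "H' = {h + of_int k * x | h k. h \<in> H}"
    have sub: "H \<subseteq> H'"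
      unfolding H'_def by (auto intro!: exI[of _ "0::int"])
    have "x \<in> H'"
      unfolding H'_def using H0 by (auto intro!: exI[of _ 0] exI[of _ "1::int"])
    with False have "H' \<noteq> H"
      by blast
    have "a - b \<in> H'" if ab: "a \<in> H'" "b \<in> H'" for a b
    proof -
      obtain h k h' k' where "a = h + of_int k * x" "b = h' + of_int k' * x" "h \<in> H" "h' \<in> H"
        using ab unfolding H'_def by blast
      then have "a - b = (h - h') + of_int (k - k') * x" "h - h' \<in> H"
        using Hdiff by (auto simp: algebra_simps)
      then show ?thesis
        unfolding H'_def by blast
    qed
    \<comment> \<open>\<open>H'\<close> is strictly larger than \<open>H\<close> and closed under
      differences, so by maximality it must contain 1. Multiplying by an inverse of \<open>k\<close>
      then solves for \<open>x\<close> modulo \<open>H\<close>.\<close>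
    with max[OF _ sub] \<open>H' \<noteq> H\<close> sub H0 have "1 \<in> H'"
      unfolding \<H>_def by blast
    then obtain h k where hk: "1 = h + of_int k * x" "h \<in> H"
      unfolding H'_def by blast
    have "\<not> p dvd k"
      using hk H1 of_int_0[of k] by auto
    then obtain l where l: "of_int l * of_int k = (1::'a)"
      using inverse_mod by blast
    have "of_int l = of_int l * h + (of_int l * of_int k) * x"
      using arg_cong[OF hk(1), of "(*) (of_int l)"] by (simp add: algebra_simps)
    then have "x - of_int l = of_int (- l) * h"
      unfolding l by (simp add: algebra_simps)
    then show ?thesis
      using Hint[OF hk(2)] by metis
  qed
  then obtain \<kappa> where \<kappa>: "\<And>x. x - of_int (\<kappa> x) \<in> H"
    by metis
  \<comment> \<open>\<open>\<kappa>\<close> is an arbitrary choice, additive only modulo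
    \<open>p\<close>: an integer lying in \<open>H\<close> is a multiple of \<open>p\<close>, and
    the exponential does not see such multiples.\<close>
  define \<psi> where "\<psi> x = cis (2 * pi * of_int (\<kappa> x) / of_int p)" for x
  have "p > 0"
    using p prime_gt_0_int by blast
  have cis_cong: "cis (2 * pi * of_int k / of_int p) = cis (2 * pi * of_int l / of_int p)"
    if kl: "p dvd k - l" for k l
  proof -
    obtain j where "k = l + p * j"
      using kl by (metis add.commute diff_add_cancel dvdE)
    then have "2 * pi * of_int k / of_int p = 2 * pi * of_int l / of_int p + 2 * pi * of_int j"
      using \<open>p > 0\<close> by (simp add: field_simps)
    then show ?thesis
      by (simp add: cis_mult[symmetric] cis_multiple_2pi)
  qed
  have add: "\<psi> (x + y) = \<psi> x * \<psi> y" for x y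
  proof -
    have "(x - of_int (\<kappa> x)) + (y - of_int (\<kappa> y)) - (x + y - of_int (\<kappa> (x + y))) \<in> H"
      by (intro Hdiff Hadd \<kappa>)
    then have "of_int (\<kappa> (x + y) - (\<kappa> x + \<kappa> y)) \<in> H"
      by (simp add: algebra_simps)
    from cis_cong[OF int_in_H[OF this]] show ?thesis
      by (simp add: \<psi>_def cis_mult ring_distribs add_divide_distrib)
  qed
  have "of_int (0 - \<kappa> 0) \<in> H" "of_int (1 - \<kappa> 1) \<in> H"
    using \<kappa>[of 0] \<kappa>[of 1] by simp_all
  from this[THEN int_in_H, THEN cis_cong]
  have zero: "\<psi> 0 = 1" and one: "\<psi> 1 = cis (2 * pi / of_int p)"
    by (simp_all add: \<psi>_def)
  have "\<psi> 1 \<noteq> 1"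
  proof
    assume "\<psi> 1 = 1"
    then have "cos (2 * pi / of_int p) = 1"
      using one by (metis cis.sel(1) one_complex.sel(1))
    then obtain j :: int where "2 * pi / of_int p = of_int j * 2 * pi"
      using cos_one_2pi_int by blast
    then have "1 = real_of_int (j * p)"
      using \<open>p > 0\<close> by (simp add: field_simps)
    then have "1 = j * p"
      by linarith
    then have "p dvd 1"
      by (metis dvd_triv_right)
    then show False
      using p not_prime_unit by blast
  qed
  with add zero show ?thesis
    by blast
qed

section \<open>Squares and the quadratic character\<close>

definition quadratic_character :: "'a::field \<Rightarrow> complex"
  where "quadratic_character s = (if \<exists>r. s = r\<^sup>2 then 1 else - 1)"

text \<open>At 0 the character takes the value 1 instead of the customary 0, so this holds for every
  argument; multiplicativity is accordingly restricted to nonzero arguments.\<close>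

lemma quadratic_character_square [simp]: "quadratic_character s ^ 2 = 1"
  by (simp add: quadratic_character_def)

lemma norm_quadratic_character [simp]: "norm (quadratic_character s) = 1"
  by (simp add: quadratic_character_def)

text \<open>In characteristic two, adding 1 is an involution without fixed points and splits the
  field into pairs. This is how odd cardinality yields invertibility of 2.\<close>

lemma even_card_of_char_two:
  assumes "(2::'a::{field,finite}) = 0"
  shows "even CARD('a)"
proof -
  have cancel: "x + 1 + 1 = x" for x :: 'a
    using assms by (simp add: add.assoc)
  have "2 * card (range (\<lambda>x::'a. {x, x + 1})) = card (\<Union> (range (\<lambda>x::'a. {x, x + 1})))"
  proof (rule card_partition)
    fix A B assume "A \<in> range (\<lambda>x::'a. {x, x + 1})" "B \<in> range (\<lambda>x::'a. {x, x + 1})" "A \<noteq> B"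
    then show "A \<inter> B = {}"
      using cancel by auto
  qed auto
  also have "\<Union> (range (\<lambda>x::'a. {x, x + 1})) = UNIV"
    by auto
  finally show ?thesis
    by (metis dvd_triv_left)
qed

lemma fermat_little:
  fixes x :: "'a::{field,finite}"
  assumes "x \<noteq> 0"
  shows "x ^ (CARD('a) - 1) = 1"
proof -
  have "(\<Prod>y\<in>UNIV-{0}. y) = (\<Prod>y\<in>UNIV-{0}. x * y)"
    by (rule prod.reindex_bij_witness[of _ "\<lambda>y. x * y" "\<lambda>y. y / x"]) (use assms in auto)
  also have "\<dots> = x ^ (CARD('a) - 1) * (\<Prod>y\<in>UNIV-{0}. y)"
    by (simp add: prod.distrib)
  finally show ?thesis
    by simp
qed

text \<open>A root of -1, raised to \<open>CARD('a) - 1\<close>, would give an odd power of -1,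
  against \<open>fermat_little\<close>. This sign is the source of the sharper odd-dimensional
  case.\<close>

lemma minus_one_nonsquare:
  assumes "CARD('a::{field,finite}) mod 4 = 3" and "(2::'a) \<noteq> 0"
  shows "quadratic_character (- 1 :: 'a) = - 1"
proof -
  have False if r: "- 1 = (r::'a)\<^sup>2" for r
  proof -
    have "r \<noteq> 0"
      using r by auto
    define k where "k = CARD('a) div 4"
    have "CARD('a) - 1 = 2 * (2 * k + 1)"
      using assms(1) unfolding k_def by presburger
    then have "1 = (r\<^sup>2) ^ (2 * k + 1)"
      using fermat_little[OF \<open>r \<noteq> 0\<close>] by (metis power_mult)
    also have "\<dots> = - 1"
      by (simp flip: r)
    finally show False
      using assms(2) by (metis add.inverse_unique one_add_one neg_equal_iff_equal add.right_inverse)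
  qed
  then show ?thesis
    by (auto simp: quadratic_character_def)
qed

text \<open>A nonzero square has the two distinct roots \<open>r\<close> and \<open>- r\<close>. A
  constant \<open>f\<close> counts the squares; a character reduces Gauss sums to sums over
  squares.\<close>

lemma sum_of_squares_twice:
  fixes f :: "'a::{field,finite} \<Rightarrow> 'b::comm_semiring_1"
  assumes two: "(2::'a) \<noteq> 0"
  shows "(\<Sum>x\<in>UNIV-{0}. f (x\<^sup>2)) = 2 * (\<Sum>s\<in>(\<lambda>x. x\<^sup>2) ` (UNIV-{0}). f s)"
proof -
  have "(\<Sum>x\<in>UNIV-{0}. f (x\<^sup>2)) =
    (\<Sum>s\<in>(\<lambda>x. x\<^sup>2) ` (UNIV-{0}). \<Sum>x\<in>{x\<in>UNIV-{0}. x\<^sup>2 = s}. f (x\<^sup>2))"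
    by (rule sum.image_gen) simp
  also have "\<dots> = (\<Sum>s\<in>(\<lambda>x. x\<^sup>2) ` (UNIV-{0}). 2 * f s)"
  proof (rule sum.cong[OF refl])
    fix s :: 'a assume "s \<in> (\<lambda>x. x\<^sup>2) ` (UNIV-{0})"
    then obtain r where r: "s = r\<^sup>2" "r \<noteq> 0"
      by auto
    then have roots: "{x\<in>UNIV-{0}. x\<^sup>2 = s} = {r, - r}"
      by (auto simp: power2_eq_iff)
    have "r \<noteq> - r"
      using two r(2) by (metis add.right_inverse mult_2 mult_eq_0_iff)
    then have "(\<Sum>x\<in>{r, - r}. f (x\<^sup>2)) = f s + f s"
      by (simp add: r(1))
    then show "(\<Sum>x\<in>{x\<in>UNIV-{0}. x\<^sup>2 = s}. f (x\<^sup>2)) = 2 * f s"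
      unfolding roots mult_2 .
  qed
  finally show ?thesis
    by (simp add: sum_distrib_left)
qed

text \<open>The two sets are disjoint and equally large, and the squares make up half of the nonzero
  elements, so nothing is left over.\<close>

lemma squares_Un_nonsquare_coset:
  fixes a :: "'a::{field,finite}"
  assumes two: "(2::'a) \<noteq> 0" and a: "\<nexists>r. a = r\<^sup>2"
  defines "S \<equiv> (\<lambda>x. x\<^sup>2) ` (UNIV-{0})"
  shows "S \<inter> (*) a ` S = {}" and "S \<union> (*) a ` S = UNIV - {0}"
proof -
  have a0: "a \<noteq> 0"
    using a by (metis zero_power2)
  show disj: "S \<inter> (*) a ` S = {}"
  proof (rule ccontr)
    assume "S \<inter> (*) a ` S \<noteq> {}"
    then obtain x y where "x\<^sup>2 = a * y\<^sup>2" "y \<noteq> 0"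
      unfolding S_def by auto
    then have "a = (x / y)\<^sup>2"
      by (simp add: power_divide)
    with a show False
      by blast
  qed
  have "card ((*) a ` S) = card S"
    using a0 by (intro card_image) (simp add: inj_on_def)
  then have "card (S \<union> (*) a ` S) = 2 * card S"
    using disj by (simp add: card_Un_disjoint)
  also have "\<dots> = card (UNIV - {0::'a})"
    using sum_of_squares_twice[OF two, of "\<lambda>_. 1::nat"] by (simp add: S_def)
  finally show "S \<union> (*) a ` S = UNIV - {0}"
    by (intro card_subset_eq) (auto simp: S_def a0)
qed

lemma quadratic_character_mult:
  fixes a b :: "'a::{field,finite}"
  assumes two: "(2::'a) \<noteq> 0" and "a \<noteq> 0" "b \<noteq> 0"
  shows "quadratic_character (a * b) = quadratic_character a * quadratic_character b"
proof -
  have square: "quadratic_character (x\<^sup>2 * y) = quadratic_character y" if "x \<noteq> 0" for x y :: 'a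
  proof -
    have "(\<exists>r. x\<^sup>2 * y = r\<^sup>2) \<longleftrightarrow> (\<exists>r. y = r\<^sup>2)"
    proof
      assume "\<exists>r. x\<^sup>2 * y = r\<^sup>2"
      then obtain r where "x\<^sup>2 * y = r\<^sup>2" ..
      then have "y = (r / x)\<^sup>2"
        using that by (simp add: power_divide field_simps)
      then show "\<exists>r. y = r\<^sup>2" ..
    qed (metis power_mult_distrib)
    then show ?thesis
      by (simp add: quadratic_character_def)
  qed
  consider x where "a = x\<^sup>2" | x where "b = x\<^sup>2"
    | "\<nexists>r. a = r\<^sup>2" "\<nexists>r. b = r\<^sup>2"
    by blast
  then show ?thesis
  proof cases
    case 1
    then show ?thesis
      using square[of x b] assms by (auto simp: quadratic_character_def)
  next
    case 2
    then show ?thesis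
      using square[of x a] assms by (auto simp: quadratic_character_def mult.commute)
  next
    case 3
    then have "b \<in> (*) a ` (\<lambda>x. x\<^sup>2) ` (UNIV-{0})"
      using squares_Un_nonsquare_coset(2)[OF two 3(1)] \<open>b \<noteq> 0\<close> by blast
    then obtain r where "b = a * r\<^sup>2"
      by auto
    then have "a * b = (a * r)\<^sup>2"
      by (simp add: power2_eq_square)
    then have "quadratic_character (a * b) = 1"
      unfolding quadratic_character_def by auto
    then show ?thesis
      using 3 by (simp add: quadratic_character_def)
  qed
qed

section \<open>Gauss sums\<close>

text \<open>From here on only the nontrivial homomorphism property matters, not the construction;
  invertibility of 2 allows completing the square.\<close>

locale additive_character =
  fixes \<psi> :: "'a::{field,finite} \<Rightarrow> complex"
  assumes zero [simp]: "\<psi> 0 = 1"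
    and add: "\<psi> (x + y) = \<psi> x * \<psi> y"
    and nontrivial: "\<exists>x. \<psi> x \<noteq> 1"
    and two: "(2::'a) \<noteq> 0"
begin

lemma sum_eq_prod: "\<psi> (sum f A) = (\<Prod>x\<in>A. \<psi> (f x))"
  by (induction A rule: infinite_finite_induct) (simp_all add: add)

lemma sum_UNIV: "(\<Sum>x\<in>UNIV. \<psi> x) = 0"
proof -
  obtain a where a: "\<psi> a \<noteq> 1"
    using nontrivial by blast
  have "(\<Sum>x\<in>UNIV. \<psi> x) = (\<Sum>x\<in>UNIV. \<psi> (a + x))"
    by (rule sum.reindex_bij_witness[of _ "\<lambda>x. a + x" "\<lambda>x. x - a"]) auto
  also have "\<dots> = \<psi> a * (\<Sum>x\<in>UNIV. \<psi> x)"
    by (simp add: add sum_distrib_left)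
  finally show ?thesis
    using a by (simp add: algebra_simps)
qed

lemma orthogonality: "(\<Sum>t\<in>UNIV. \<psi> (t * v)) = (if v = 0 then of_nat CARD('a) else 0)"
proof (cases "v = 0")
  case False
  have "(\<Sum>t\<in>UNIV. \<psi> (t * v)) = (\<Sum>x\<in>UNIV. \<psi> x)"
    by (rule sum.reindex_bij_witness[of _ "\<lambda>x. x / v" "\<lambda>x. x * v"]) (use False in auto)
  with False show ?thesis
    by (simp add: sum_UNIV)
qed simp

text \<open>The frequency 0 carries the average of a count, so the nonzero frequencies measure the
  deviation from it.\<close>

lemma orthogonality_nonzero:
  "(\<Sum>t\<in>UNIV-{0}. \<psi> (t * v)) = (if v = 0 then of_nat CARD('a) else 0) - 1"
proof -
  have "(\<Sum>t\<in>UNIV. \<psi> (t * v)) = 1 + (\<Sum>t\<in>UNIV-{0}. \<psi> (t * v))"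
    by (simp add: sum.remove[of UNIV 0])
  then show ?thesis
    unfolding orthogonality by (simp only: add_diff_cancel_left')
qed

definition gauss :: "'a \<Rightarrow> 'a \<Rightarrow> complex"
  where "gauss s b = (\<Sum>x\<in>UNIV. \<psi> (s * x\<^sup>2 + b * x))"

lemma gauss_zero: "gauss 0 b = (if b = 0 then of_nat CARD('a) else 0)"
  using orthogonality[of b] by (simp add: gauss_def mult.commute)

lemma gauss_complete_square:
  assumes "s \<noteq> 0"
  shows "gauss s b = \<psi> (- (b\<^sup>2 / (4 * s))) * gauss s 0"
proof -
  have four: "(4::'a) \<noteq> 0"
    using two by (metis mult_2 mult_eq_0_iff numeral_Bit0)
  have "s * x\<^sup>2 + b * x = - (b\<^sup>2 / (4 * s)) + s * (x + b / (2 * s))\<^sup>2" for x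
  proof -
    have "s * (x + b / (2 * s))\<^sup>2 = s * x\<^sup>2 + b * x + b\<^sup>2 / (4 * s)"
      using assms two four by (simp add: power2_eq_square field_simps)
    then show ?thesis
      by simp
  qed
  then have "gauss s b = \<psi> (- (b\<^sup>2 / (4 * s))) * (\<Sum>x\<in>UNIV. \<psi> (s * (x + b / (2 * s))\<^sup>2))"
    by (simp only: gauss_def add sum_distrib_left)
  also have "(\<Sum>x\<in>UNIV. \<psi> (s * (x + b / (2 * s))\<^sup>2)) = (\<Sum>x\<in>UNIV. \<psi> (s * x\<^sup>2))"
    by (rule sum.reindex_bij_witness[of _ "\<lambda>x. x - b / (2 * s)" "\<lambda>x. x + b / (2 * s)"]) auto
  finally show ?thesis
    by (simp add: gauss_def)
qed

text \<open>Substituting \<open>x = y + a\<close> makes the exponent linear in \<open>y\<close>, so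
  the sum over \<open>y\<close> kills every \<open>a\<close> except 0.\<close>

lemma gauss_mult_minus:
  assumes "s \<noteq> 0"
  shows "gauss s 0 * gauss (- s) 0 = of_nat CARD('a)"
proof -
  have "gauss s 0 * gauss (- s) 0 = (\<Sum>y\<in>UNIV. \<Sum>x\<in>UNIV. \<psi> (s * x\<^sup>2 - s * y\<^sup>2))"
    by (subst sum.swap) (simp add: gauss_def sum_product flip: add)
  also have "\<dots> = (\<Sum>y\<in>UNIV. \<Sum>a\<in>UNIV. \<psi> (s * a\<^sup>2) * \<psi> (y * (2 * s * a)))"
  proof (rule sum.cong[OF refl])
    fix y :: 'a
    show "(\<Sum>x\<in>UNIV. \<psi> (s * x\<^sup>2 - s * y\<^sup>2)) = (\<Sum>a\<in>UNIV. \<psi> (s * a\<^sup>2) * \<psi> (y * (2 * s * a)))"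
      by (rule sum.reindex_bij_witness[of _ "\<lambda>a. y + a" "\<lambda>x. x - y"])
        (auto simp: power2_eq_square algebra_simps simp flip: add)
  qed
  also have "\<dots> = (\<Sum>a\<in>UNIV. \<psi> (s * a\<^sup>2) * (\<Sum>y\<in>UNIV. \<psi> (y * (2 * s * a))))"
    by (subst sum.swap) (simp add: sum_distrib_left)
  also have "\<dots> = (\<Sum>a::'a\<in>UNIV. if a = 0 then of_nat CARD('a) else 0)"
  proof (rule sum.cong[OF refl])
    fix a :: 'a
    show "\<psi> (s * a\<^sup>2) * (\<Sum>y\<in>UNIV. \<psi> (y * (2 * s * a))) =
      (if a = 0 then of_nat CARD('a) else 0)"
      unfolding orthogonality using assms two by auto
  qed
  finally show ?thesis
    by simp
qed

text \<open>A square \<open>s\<close> is absorbed by rescaling \<open>x\<close>. For a nonsquare,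
  the squares and their \<open>s\<close>-multiples together exhaust the nonzero elements, so the two
  Gauss sums add up to 2 + 2 * (-1) = 0.\<close>

lemma gauss_quadratic_character:
  assumes "s \<noteq> 0"
  shows "gauss s 0 = quadratic_character s * gauss 1 0"
proof (cases "\<exists>r. s = r\<^sup>2")
  case True
  then obtain r where r: "s = r\<^sup>2" ..
  with assms have "r \<noteq> 0"
    by auto
  then have "gauss s 0 = gauss 1 0"
    unfolding gauss_def
    by (intro sum.reindex_bij_witness[of _ "\<lambda>x. x / r" "\<lambda>x. r * x"]) (auto simp: r power_mult_distrib)
  with True show ?thesis
    by (simp add: quadratic_character_def)
next
  case False
  define S :: "'a set" where "S = (\<lambda>x. x\<^sup>2) ` (UNIV-{0})"
  have gauss_S: "gauss t 0 = 1 + 2 * (\<Sum>x\<in>S. \<psi> (t * x))" for t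
    using sum_of_squares_twice[OF two, of "\<lambda>x. \<psi> (t * x)"]
    by (simp add: gauss_def S_def sum.remove[of UNIV 0])
  have "(\<Sum>x\<in>S. \<psi> (s * x)) = (\<Sum>x\<in>(*) s ` S. \<psi> x)"
    using assms by (subst sum.reindex) (auto simp: inj_on_def)
  then have "(\<Sum>x\<in>S. \<psi> x) + (\<Sum>x\<in>S. \<psi> (s * x)) = (\<Sum>x\<in>S \<union> (*) s ` S. \<psi> x)"
    using squares_Un_nonsquare_coset(1)[OF two False] by (simp add: S_def sum.union_disjoint)
  also have "\<dots> = (\<Sum>x\<in>UNIV-{0}. \<psi> x)"
    using squares_Un_nonsquare_coset(2)[OF two False] by (simp add: S_def)
  also have "\<dots> = - 1"
    using orthogonality_nonzero[of 1] by simp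
  finally have "gauss 1 0 + gauss s 0 = 0"
    unfolding gauss_S by (simp flip: distrib_left add: add_ac)
  with False show ?thesis
    by (simp add: quadratic_character_def eq_neg_iff_add_eq_0 add.commute)
qed

lemma gauss_square: "gauss 1 0 ^ 2 = quadratic_character (- 1 :: 'a) * of_nat CARD('a)"
proof -
  have "quadratic_character (- 1 :: 'a) * gauss 1 0 ^ 2 = of_nat CARD('a)"
    using gauss_mult_minus[of 1] gauss_quadratic_character[of "- 1"]
    by (simp add: power2_eq_square algebra_simps)
  then show ?thesis
    by (metis mult.assoc mult_1 power2_eq_square quadratic_character_square)
qed

lemma norm_gauss_square: "norm (gauss 1 0) ^ 2 = real CARD('a)"
  using arg_cong[OF gauss_square, of norm] by (simp add: norm_mult norm_power)

end

section \<open>Hyperplane sections of the cone\<close>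

lemma sum_prod_vec:
  fixes f :: "'n::finite \<Rightarrow> 'a::finite \<Rightarrow> 'b::comm_semiring_1"
  shows "(\<Sum>x\<in>UNIV. \<Prod>i\<in>UNIV. f i (x $ i)) = (\<Prod>i\<in>UNIV. \<Sum>a\<in>UNIV. f i a)"
proof -
  have "(\<Sum>x\<in>UNIV. \<Prod>i\<in>UNIV. f i (x $ i)) = (\<Sum>g\<in>UNIV \<rightarrow>\<^sub>E UNIV. \<Prod>i\<in>UNIV. f i (g i))"
    by (rule sum.reindex_bij_witness[of _ vec_lambda vec_nth]) auto
  then show ?thesis
    by (simp add: prod_sum_PiE)
qed

lemma sum_if_const:
  fixes k :: "'b::semiring_1"
  assumes "finite A"
  shows "(\<Sum>x\<in>A. if P x then k else 0) = of_nat (card {x\<in>A. P x}) * k"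
  unfolding sum.inter_filter[OF assms, symmetric] by (rule sum_constant)

text \<open>For \<open>c\<^sup>2 = 1\<close> this is the section of the unit sphere by the
  hyperplane: coordinate \<open>m\<close> already contributes the full norm 1.\<close>

definition cone_section :: "'n::finite \<Rightarrow> 'a \<Rightarrow> ('a::field ^ 'n) set"
  where "cone_section m c = {x. x $ m = c \<and> (\<Sum>i\<in>UNIV-{m}. (x $ i)\<^sup>2) = 0}"

text \<open>The factor \<open>CARD('a)\<close> clears the denominator of the expected proportion 1/q
  of points orthogonal to \<open>u\<close>.\<close>

definition discrepancy :: "'n::finite \<Rightarrow> 'a \<Rightarrow> 'a::{field,finite} ^ 'n \<Rightarrow> real"
  where "discrepancy m c u =
    real CARD('a) * real (card {x\<in>cone_section m c. scalar_product u x = 0})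
      - real (card (cone_section m c :: ('a ^ 'n) set))"

text \<open>Up to scaling, the sum of squares is its own dual form, so completing the square on the
  cone returns it evaluated at \<open>u\<close>.\<close>

definition truncated_form :: "'n::finite \<Rightarrow> 'a::field ^ 'n \<Rightarrow> 'a"
  where "truncated_form m u = (\<Sum>i\<in>UNIV-{m}. (u $ i)\<^sup>2)"

section \<open>Evaluation of the discrepancy by Gauss sums\<close>

context additive_character
begin

lemma discrepancy_eq_sum:
  "complex_of_real (discrepancy m c u) =
    (\<Sum>t\<in>UNIV-{0}. \<Sum>x\<in>cone_section m c. \<psi> (t * scalar_product u x))"
proof -
  have "(\<Sum>t\<in>UNIV-{0}. \<Sum>x\<in>cone_section m c. \<psi> (t * scalar_product u x)) =
    (\<Sum>x\<in>cone_section m c. (if scalar_product u x = 0 then of_nat CARD('a) else 0) - 1)"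
    by (subst sum.swap) (simp only: orthogonality_nonzero)
  also have "\<dots> = of_nat (card {x\<in>cone_section m c. scalar_product u x = 0}) * of_nat CARD('a)
      - of_nat (card (cone_section m c :: ('a ^ 'b) set))"
    by (simp add: sum_subtractf sum_if_const)
  finally show ?thesis
    by (simp add: discrepancy_def mult.commute)
qed

text \<open>A second frequency \<open>s\<close> detects the cone equation. The exponent then
  separates over the coordinates: each free one yields a Gauss sum, and coordinate \<open>m\<close>
  is frozen at \<open>c\<close>.\<close>

lemma sum_cone_section:
  "of_nat CARD('a) * (\<Sum>x\<in>cone_section m c. \<psi> (t * scalar_product u x)) =
    (\<Sum>s\<in>UNIV. \<psi> (t * (u $ m * c)) * (\<Prod>i\<in>UNIV-{m}. gauss s (t * u $ i)))"
proof -
  \<comment> \<open>The constraint on coordinate \<open>m\<close> becomes a factor vanishing off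
    \<open>c\<close>, so that the sum over all vectors factorizes.\<close>
  define F where "F s i a =
    (if i = m then if a = c then \<psi> (t * (u $ m * c)) else 0 else \<psi> (s * a\<^sup>2 + t * u $ i * a))" for s i a
  have F_prod: "(\<Prod>i\<in>UNIV. F s i (x $ i)) =
    (if x $ m = c then \<psi> (t * scalar_product u x) * \<psi> (s * (\<Sum>i\<in>UNIV-{m}. (x $ i)\<^sup>2)) else 0)" for s x
  proof -
    have "(\<Prod>i\<in>UNIV. F s i (x $ i)) =
      F s m (x $ m) * \<psi> (\<Sum>i\<in>UNIV-{m}. s * (x $ i)\<^sup>2 + t * u $ i * x $ i)"
      by (simp add: prod.remove[of UNIV m] F_def sum_eq_prod)
    moreover have "scalar_product u x = u $ m * x $ m + (\<Sum>i\<in>UNIV-{m}. u $ i * x $ i)"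
      by (simp add: scalar_product_def sum.remove[of UNIV m])
    ultimately show ?thesis
      by (simp add: F_def sum.distrib sum_distrib_left mult.assoc ring_distribs flip: add)
        (simp add: ac_simps)
  qed
  have "(\<Sum>s\<in>UNIV. \<psi> (t * (u $ m * c)) * (\<Prod>i\<in>UNIV-{m}. gauss s (t * u $ i))) =
    (\<Sum>s\<in>UNIV. \<Prod>i\<in>UNIV. \<Sum>a\<in>UNIV. F s i a)"
    by (simp add: prod.remove[of UNIV m] F_def gauss_def)
  also have "\<dots> = (\<Sum>x\<in>UNIV. \<Sum>s\<in>UNIV. \<Prod>i\<in>UNIV. F s i (x $ i))"
    by (subst sum.swap) (simp add: sum_prod_vec)
  also have "\<dots> = (\<Sum>x\<in>UNIV. if x \<in> cone_section m c then of_nat CARD('a) * \<psi> (t * scalar_product u x) else 0)"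
  proof (rule sum.cong[OF refl])
    fix x :: "'a ^ 'b"
    show "(\<Sum>s\<in>UNIV. \<Prod>i\<in>UNIV. F s i (x $ i)) =
      (if x \<in> cone_section m c then of_nat CARD('a) * \<psi> (t * scalar_product u x) else 0)"
      unfolding F_prod using orthogonality[of "\<Sum>i\<in>UNIV-{m}. (x $ i)\<^sup>2"]
      by (cases "x $ m = c") (simp_all add: cone_section_def flip: sum_distrib_left)
  qed
  also have "\<dots> = (\<Sum>x\<in>cone_section m c. of_nat CARD('a) * \<psi> (t * scalar_product u x))"
    by (simp flip: sum.inter_restrict)
  finally show ?thesis
    by (simp add: sum_distrib_left)
qed

text \<open>The frequency \<open>s = 0\<close> produces the main term, supported on the multiples of
  the \<open>m\<close>-th basis vector.\<close>

lemma prod_gauss_zero: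
  assumes "t \<noteq> 0"
  shows "(\<Prod>i\<in>UNIV-{m}. gauss 0 (t * u $ i)) =
    (if \<forall>i\<in>UNIV-{m}. u $ i = 0 then of_nat CARD('a) ^ card (UNIV-{m}) else 0)"
  using assms by (auto simp: gauss_zero intro!: prod_zero)

lemma prod_gauss_nonzero:
  assumes "s \<noteq> 0"
  shows "(\<Prod>i\<in>UNIV-{m}. gauss s (t * u $ i)) =
    (quadratic_character s * gauss 1 0) ^ card (UNIV-{m})
      * \<psi> (- (t\<^sup>2 / (4 * s)) * truncated_form m u)"
proof -
  have "(\<Prod>i\<in>UNIV-{m}. gauss s (t * u $ i)) =
    (\<Prod>i\<in>UNIV-{m}. \<psi> (- (t\<^sup>2 / (4 * s)) * (u $ i)\<^sup>2) * (quadratic_character s * gauss 1 0))"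
  proof (rule prod.cong[OF refl])
    fix i
    have "- ((t * u $ i)\<^sup>2 / (4 * s)) = - (t\<^sup>2 / (4 * s)) * (u $ i)\<^sup>2"
      by (simp add: power_mult_distrib)
    then show "gauss s (t * u $ i) =
      \<psi> (- (t\<^sup>2 / (4 * s)) * (u $ i)\<^sup>2) * (quadratic_character s * gauss 1 0)"
      using gauss_complete_square[OF assms, of "t * u $ i"] gauss_quadratic_character[OF assms]
      by (simp only:)
  qed
  also have "\<dots> = \<psi> (\<Sum>i\<in>UNIV-{m}. - (t\<^sup>2 / (4 * s)) * (u $ i)\<^sup>2)
      * (quadratic_character s * gauss 1 0) ^ card (UNIV-{m})"
    by (simp only: prod.distrib prod_constant sum_eq_prod power_mult_distrib)
  also have "(\<Sum>i\<in>UNIV-{m}. - (t\<^sup>2 / (4 * s)) * (u $ i)\<^sup>2) = - (t\<^sup>2 / (4 * s)) * truncated_form m u"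
    by (simp only: truncated_form_def sum_distrib_left)
  finally show ?thesis
    by (simp only: mult.commute)
qed

text \<open>Only the parity of \<open>n\<close> matters: an even \<open>n\<close> removes the
  quadratic character, an odd \<open>n\<close> leaves the Gauss sum attached to it.\<close>

definition twisted_sum :: "nat \<Rightarrow> 'a \<Rightarrow> complex"
  where "twisted_sum n v = (\<Sum>s\<in>UNIV-{0}. quadratic_character s ^ n * \<psi> (s * v))"

text \<open>The involution sending \<open>s\<close> to \<open>- (t\<^sup>2 / (4 * s))\<close> makes
  the phase linear. Modulo squares it is multiplication by -1, so the result no longer depends on
  \<open>t\<close>.\<close>

lemma sum_prod_gauss_nonzero:
  fixes u :: "'a ^ 'n::finite" and m :: 'n
  assumes "t \<noteq> 0"
  defines "n \<equiv> card (UNIV - {m})"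
  shows "(\<Sum>s\<in>UNIV-{0}. \<Prod>i\<in>UNIV-{m}. gauss s (t * u $ i)) =
    (gauss 1 0 * quadratic_character (- 1 :: 'a)) ^ n * twisted_sum n (truncated_form m u)"
proof -
  have four: "(4::'a) \<noteq> 0"
    using two by (metis mult_2 mult_eq_0_iff numeral_Bit0)
  define j where "j s = - (t\<^sup>2 / (4 * s))" for s
  have j: "j s \<noteq> 0" "j (j s) = s" if "s \<noteq> 0" for s
    using that assms(1) four by (auto simp: j_def)
  have chi_j: "quadratic_character (j s) = quadratic_character (- 1 :: 'a) * quadratic_character s"
    if "s \<noteq> 0" for s
  proof -
    have "j s = (- 1) * (s * (t / (2 * s))\<^sup>2)"
      using that by (simp add: j_def power2_eq_square)
    moreover have "quadratic_character ((t / (2 * s))\<^sup>2) = 1"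
      by (auto simp: quadratic_character_def)
    ultimately show ?thesis
      using that assms(1) two quadratic_character_mult[OF two, of "- 1" "s * (t / (2 * s))\<^sup>2"]
        quadratic_character_mult[OF two, of s "(t / (2 * s))\<^sup>2"] by simp
  qed
  have "(\<Sum>s\<in>UNIV-{0}. \<Prod>i\<in>UNIV-{m}. gauss s (t * u $ i)) =
    (\<Sum>s\<in>UNIV-{0}. (quadratic_character s * gauss 1 0) ^ n * \<psi> (j s * truncated_form m u))"
    by (simp add: prod_gauss_nonzero j_def n_def)
  also have "\<dots> = (\<Sum>s\<in>UNIV-{0}. (quadratic_character (j s) * gauss 1 0) ^ n * \<psi> (s * truncated_form m u))"
    by (rule sum.reindex_bij_witness[of _ j j]) (auto simp: j)
  also have "\<dots> = (\<Sum>s\<in>UNIV-{0}. (gauss 1 0 * quadratic_character (- 1 :: 'a)) ^ n *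
      (quadratic_character s ^ n * \<psi> (s * truncated_form m u)))"
    by (simp add: chi_j power_mult_distrib ac_simps)
  finally show ?thesis
    by (simp add: twisted_sum_def sum_distrib_left)
qed

text \<open>Since the sum over \<open>s\<close> is the same for all nonzero \<open>t\<close>, the
  sum over \<open>t\<close> only sees \<open>u $ m * c\<close>, which vanishes exactly when
  \<open>u $ m\<close> does.\<close>

lemma discrepancy_formula:
  fixes u :: "'a ^ 'n::finite" and m :: 'n
  defines "n \<equiv> card (UNIV - {m})"
  assumes "c \<noteq> 0"
  shows "of_nat CARD('a) * complex_of_real (discrepancy m c u) =
    ((if u $ m = 0 then of_nat CARD('a) else 0) - 1) *
    ((if \<forall>i\<in>UNIV-{m}. u $ i = 0 then of_nat CARD('a) ^ n else 0)
      + (gauss 1 0 * quadratic_character (- 1 :: 'a)) ^ n * twisted_sum n (truncated_form m u))"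
    (is "_ = _ * ?R")
proof -
  have "of_nat CARD('a) * complex_of_real (discrepancy m c u) =
    (\<Sum>t\<in>UNIV-{0}. \<psi> (t * (u $ m * c)) * (\<Sum>s\<in>UNIV. \<Prod>i\<in>UNIV-{m}. gauss s (t * u $ i)))"
    unfolding discrepancy_eq_sum sum_distrib_left[of "of_nat CARD('a)" _ "UNIV-{0}"] sum_cone_section
    by (simp only: flip: sum_distrib_left)
  also have "\<dots> = (\<Sum>t\<in>UNIV-{0}. \<psi> (t * (u $ m * c)) * ?R)"
  proof (rule sum.cong[OF refl])
    fix t :: 'a assume "t \<in> UNIV - {0}"
    then have t: "t \<noteq> 0"
      by simp
    have "(\<Sum>s\<in>UNIV. \<Prod>i\<in>UNIV-{m}. gauss s (t * u $ i)) =
      (\<Prod>i\<in>UNIV-{m}. gauss 0 (t * u $ i)) + (\<Sum>s\<in>UNIV-{0}. \<Prod>i\<in>UNIV-{m}. gauss s (t * u $ i))"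
      by (rule sum.remove) auto
    then show "\<psi> (t * (u $ m * c)) * (\<Sum>s\<in>UNIV. \<Prod>i\<in>UNIV-{m}. gauss s (t * u $ i)) =
      \<psi> (t * (u $ m * c)) * ?R"
      unfolding prod_gauss_zero[OF t] sum_prod_gauss_nonzero[OF t] n_def by simp
  qed
  also have "\<dots> = ((if u $ m = 0 then of_nat CARD('a) else 0) - 1) * ?R"
    using assms(2) orthogonality_nonzero[of "u $ m * c"] by (simp flip: sum_distrib_right)
  finally show ?thesis .
qed

section \<open>Bounds for the twisted sums and the discrepancy\<close>

lemma twisted_sum_even:
  assumes "even n"
  shows "twisted_sum n v = (if v = 0 then of_nat CARD('a) else 0) - 1"
proof -
  have "quadratic_character s ^ n = 1" for s :: 'a
    using assms by (auto elim!: evenE simp: power_mult)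
  then show ?thesis
    using orthogonality_nonzero[of v] by (simp add: twisted_sum_def)
qed

text \<open>The extra Gauss factor turns the quadratic character back into \<open>gauss s 0\<close>;
  summing over \<open>s\<close> then counts the roots of \<open>x\<^sup>2 = - v\<close>, of which
  there are at most two. Bounding the product avoids square roots of q.\<close>

lemma norm_gauss_twisted_sum_odd:
  assumes "odd n"
  shows "norm (gauss 1 0 * twisted_sum n v) \<le> real CARD('a)"
proof -
  have "quadratic_character s ^ n = quadratic_character s" for s :: 'a
    using assms by (auto elim!: oddE simp: power_mult)
  then have "gauss 1 0 * twisted_sum n v =
    (\<Sum>s\<in>UNIV-{0}. (quadratic_character s * gauss 1 0) * \<psi> (s * v))"
    by (simp add: twisted_sum_def sum_distrib_left ac_simps)
  also have "\<dots> = (\<Sum>s\<in>UNIV-{0}. gauss s 0 * \<psi> (s * v))"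
    by (intro sum.cong refl) (metis gauss_quadratic_character Diff_iff singletonI)
  also have "\<dots> = (\<Sum>s\<in>UNIV-{0}. \<Sum>x\<in>UNIV. \<psi> (s * (x\<^sup>2 + v)))"
    by (simp add: gauss_def sum_distrib_right ring_distribs add)
  also have "\<dots> = (\<Sum>x\<in>UNIV. (if x\<^sup>2 + v = 0 then of_nat CARD('a) else 0) - 1)"
    by (subst sum.swap) (simp only: orthogonality_nonzero)
  also have "\<dots> = of_nat CARD('a) * (of_nat (card {x. x\<^sup>2 + v = 0}) - 1)"
    by (simp add: sum_subtractf sum_if_const algebra_simps)
  finally have eq: "gauss 1 0 * twisted_sum n v =
    of_nat CARD('a) * (of_nat (card {x. x\<^sup>2 + v = 0}) - 1)" .
  have "card {x. x\<^sup>2 + v = 0} \<le> 2"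
  proof (cases "{x. x\<^sup>2 + v = 0} = {}")
    case False
    then obtain r where "r\<^sup>2 + v = 0"
      by blast
    then have "x\<^sup>2 + v = 0 \<longleftrightarrow> x\<^sup>2 = r\<^sup>2" for x
      by (metis add_right_cancel)
    then have "{x. x\<^sup>2 + v = 0} \<subseteq> {r, - r}"
      by (auto simp: power2_eq_iff)
    then have "card {x. x\<^sup>2 + v = 0} \<le> card {r, - r}"
      by (rule card_mono[rotated]) simp
    also have "\<dots> \<le> 2"
      by (simp add: card_insert_if)
    finally show ?thesis .
  qed simp
  then have "\<bar>real (card {x. x\<^sup>2 + v = 0}) - 1\<bar> \<le> 1"
    by linarith
  moreover have "norm (of_nat (card {x. x\<^sup>2 + v = 0}) - 1 :: complex) = \<bar>real (card {x. x\<^sup>2 + v = 0}) - 1\<bar>"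
    by (metis norm_of_real of_real_1 of_real_diff of_real_of_nat_eq real_norm_def)
  ultimately show ?thesis
    unfolding eq norm_mult by (simp add: mult_left_le)
qed

lemma norm_gauss_power_even: "norm (gauss 1 0) ^ (2 * k) = real CARD('a) ^ k"
  by (simp add: power_mult norm_gauss_square)

end

text \<open>The bound is one-sided on purpose: in the special case the largest contribution to the
  error is negative, which saves a factor q over the bound by absolute values.\<close>

lemma (in additive_character) discrepancy_le:
  fixes u :: "'a ^ 'n::finite" and m :: 'n
  defines "n \<equiv> card (UNIV - {m})"
  assumes "c \<noteq> 0"
  shows "discrepancy m c u \<le> (if u = 0 then real CARD('a) ^ n else 0) +
    (if odd n then real CARD('a) ^ ((n + 1) div 2)
     else if n mod 4 = 2 \<and> CARD('a) mod 4 = 3 then real CARD('a) ^ (n div 2)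
     else real CARD('a) ^ (n div 2 + 1))"
    (is "_ \<le> ?main + ?error")
proof -
  let ?q = "real CARD('a)" and ?v = "truncated_form m u"
  let ?\<eta> = "quadratic_character (- 1 :: 'a)"
  define L where "L = (if u $ m = 0 then ?q else 0) - 1"
  define \<delta> where "\<delta> = (if \<forall>i\<in>UNIV-{m}. u $ i = 0 then ?q ^ n else 0)"
  define W where "W = (gauss 1 0 * ?\<eta>) ^ n * twisted_sum n ?v"
  have q1: "?q \<ge> 1"
    using finite_UNIV_card_ge_0[where ?'a = 'a] by simp
  have L: "\<bar>L\<bar> \<le> ?q"
    using q1 by (auto simp: L_def)
  have "complex_of_real (?q * discrepancy m c u) = complex_of_real L * (complex_of_real \<delta> + W)"
    using discrepancy_formula[OF assms(2), of m u] by (simp add: L_def \<delta>_def W_def n_def)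
  from arg_cong[OF this, of Re] have split: "?q * discrepancy m c u = L * \<delta> + L * Re W"
    by (simp add: distrib_left)
  \<comment> \<open>If only \<open>u $ m\<close> is nonzero, then \<open>\<delta>\<close> is large
    but \<open>L = - 1\<close>, so the main term is negative and survives in the bound only at
    \<open>u = 0\<close>.\<close>
  have "u = 0 \<longleftrightarrow> u $ m = 0 \<and> (\<forall>i\<in>UNIV-{m}. u $ i = 0)"
    by (auto simp: vec_eq_iff)
  then have main: "L * \<delta> \<le> ?q * ?main"
    using q1 by (auto simp: L_def \<delta>_def mult_right_mono)
  have norm_W: "norm W = norm (gauss 1 0) ^ n * norm (twisted_sum n ?v)"
    by (simp add: W_def norm_mult norm_power)
  have le_norm: "L * Re W \<le> ?q * norm W"
  proof -
    have "L * Re W \<le> \<bar>L\<bar> * \<bar>Re W\<bar>"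
      by (metis abs_ge_self abs_mult)
    also have "\<dots> \<le> ?q * norm W"
      using L abs_Re_le_cmod by (intro mult_mono) auto
    finally show ?thesis .
  qed
  have "L * Re W \<le> ?q * ?error"
  proof (cases "even n")
    case False
    then obtain k where k: "n = 2 * k + 1"
      by (elim oddE)
    have "norm W = ?q ^ k * norm (gauss 1 0 * twisted_sum n ?v)"
      using norm_gauss_power_even[of k] unfolding norm_W by (simp add: k norm_mult)
    also have "\<dots> \<le> ?q ^ k * ?q"
      using norm_gauss_twisted_sum_odd[OF False] by (intro mult_left_mono) auto
    also have "\<dots> = ?q ^ ((n + 1) div 2)"
      by (simp add: k)
    finally have "?q * norm W \<le> ?q * ?q ^ ((n + 1) div 2)"
      by (intro mult_left_mono) auto
    from order_trans[OF le_norm this] False show ?thesis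
      by simp
  next
    case True
    then obtain k where k: "n = 2 * k"
      by (elim evenE)
    define H where "H = (if ?v = 0 then ?q else 0) - 1"
    have H: "twisted_sum n ?v = complex_of_real H"
      using twisted_sum_even[OF True] by (simp add: H_def)
    show ?thesis
    proof (cases "n mod 4 = 2 \<and> CARD('a) mod 4 = 3")
      case special: True
      then have "odd k"
        unfolding k by presburger
      \<comment> \<open>The square of the Gauss sum is -q here, and \<open>k\<close> is odd.\<close>
      have "(gauss 1 0 * ?\<eta>) ^ n = - (complex_of_real ?q ^ k)"
        using minus_one_nonsquare[OF _ two] special \<open>odd k\<close>
        by (simp add: k power_mult power_mult_distrib gauss_square power_minus_odd)
      then have "W = complex_of_real (- (?q ^ k) * H)"
        by (simp add: W_def H)
      then have "L * Re W = ?q ^ k * (- (L * H))"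
        by (simp only: Re_complex_of_real) simp
      also have "\<dots> \<le> ?q ^ k * ?q"
      proof (rule mult_left_mono)
        \<comment> \<open>\<open>L\<close> and \<open>H\<close> each equal q - 1 or -1; the product
          of size (q - 1)^2 enters with a minus sign, and opposite signs give only q - 1.\<close>
        have "- ((?q - 1) * (?q - 1)) \<le> ?q"
          using mult_nonneg_nonneg[of "?q - 1" "?q - 1"] q1 by linarith
        then show "- (L * H) \<le> ?q"
          using q1 by (auto simp: L_def H_def)
      qed simp
      finally show ?thesis
        using special True by (simp add: k mult.commute)
    next
      case False
      have "norm (twisted_sum n ?v) \<le> ?q"
        using q1 unfolding H norm_of_real by (auto simp: H_def)
      then have "norm W \<le> ?q ^ k * ?q"
        unfolding norm_W k norm_gauss_power_even by (intro mult_left_mono) (auto simp: k)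
      then have "?q * norm W \<le> ?q * ?q ^ (n div 2 + 1)"
        by (intro mult_left_mono) (auto simp: k mult.commute)
      from order_trans[OF le_norm this] False True show ?thesis
        by auto
    qed
  qed
  with split main have "?q * discrepancy m c u \<le> ?q * (?main + ?error)"
    by (simp only: distrib_left)
  then show ?thesis
    using q1 by (simp only: mult_le_cancel_left_pos[of ?q])
qed

section \<open>Counting collisions\<close>

text \<open>Cauchy-Schwarz on the fibre sizes of \<open>f\<close>, whose squares add up to the
  number of collisions.\<close>

lemma card_square_le_collisions:
  assumes "finite A"
  shows "(real (card A))\<^sup>2 \<le> real (card (f ` A)) * real (card {p\<in>A \<times> A. f (fst p) = f (snd p)})"
proof -
  let ?F = "\<lambda>v. {x\<in>A. f x = v}"
  have "card A = (\<Sum>v\<in>f ` A. card (?F v))"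
    using sum.image_gen[OF assms, of "\<lambda>_. 1::nat" f] by simp
  then have "(real (card A))\<^sup>2 = (\<Sum>v\<in>f ` A. real (card (?F v)))\<^sup>2"
    by simp
  also have "\<dots> \<le> (\<Sum>v\<in>f ` A. (real (card (?F v)))\<^sup>2) * real (card (f ` A))"
    using Cauchy_Schwarz_ineq_sum[of "\<lambda>v. real (card (?F v))" "\<lambda>_. 1" "f ` A"] by simp
  also have "(\<Sum>v\<in>f ` A. (real (card (?F v)))\<^sup>2) = real (\<Sum>v\<in>f ` A. card (?F v \<times> ?F v))"
    by (simp add: card_cartesian_product power2_eq_square)
  also have "(\<Sum>v\<in>f ` A. card (?F v \<times> ?F v)) = card (\<Union>v\<in>f ` A. ?F v \<times> ?F v)"
    using assms by (intro card_UN_disjoint [symmetric]) auto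
  also have "(\<Union>v\<in>f ` A. ?F v \<times> ?F v) = {p\<in>A \<times> A. f (fst p) = f (snd p)}"
    by auto
  finally show ?thesis
    by (simp add: mult.commute)
qed

text \<open>A collision of \<open>z\<close> and \<open>w\<close> at \<open>x\<close> means that
  \<open>z - w\<close> is orthogonal to \<open>x\<close>. After exchanging sums, the subtracted
  square of \<open>card E\<close> supplies the cardinality of the section once per pair.\<close>

lemma sum_collisions_eq_discrepancy:
  fixes E :: "('a::{field,finite} ^ 'n::finite) set"
  shows "(\<Sum>x\<in>cone_section m c. real CARD('a) *
      real (card {p\<in>E \<times> E. scalar_product (fst p) x = scalar_product (snd p) x}) - (real (card E))\<^sup>2) =
    (\<Sum>p\<in>E \<times> E. discrepancy m c (fst p - snd p))"
proof -
  let ?C = "cone_section m c :: ('a ^ 'n) set"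
  have diff: "scalar_product (z - w) x = 0 \<longleftrightarrow> scalar_product z x = scalar_product w x"
    for z w x :: "'a ^ 'n"
    by (simp add: scalar_product_def left_diff_distrib sum_subtractf)
  have "(\<Sum>x\<in>?C. real (card {p\<in>E \<times> E. scalar_product (fst p) x = scalar_product (snd p) x})) =
    (\<Sum>x\<in>?C. \<Sum>p\<in>E \<times> E. if scalar_product (fst p - snd p) x = 0 then 1 else 0)"
    by (simp add: sum_if_const diff)
  also have "\<dots> = (\<Sum>p\<in>E \<times> E. real (card {x\<in>?C. scalar_product (fst p - snd p) x = 0}))"
    by (subst sum.swap) (simp add: sum_if_const)
  finally have eq: "(\<Sum>x\<in>?C. real (card {p\<in>E \<times> E. scalar_product (fst p) x = scalar_product (snd p) x})) =
    (\<Sum>p\<in>E \<times> E. real (card {x\<in>?C. scalar_product (fst p - snd p) x = 0}))" .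
  show ?thesis
    unfolding discrepancy_def sum_subtractf sum_distrib_left [symmetric] eq
    by (simp add: card_cartesian_product power2_eq_square)
qed

lemma card_few_values_le:
  fixes E :: "('a::{field,finite} ^ 'n::finite) set"
  assumes "E \<noteq> {}" and N: "0 < N" "N < real CARD('a)"
    and disc: "\<And>u. discrepancy m c u \<le> (if u = 0 then A else 0) + B"
  shows "real (card {x\<in>cone_section m c. real (card ((\<lambda>z. scalar_product z x) ` E)) \<le> N}) \<le>
    N * A / ((real CARD('a) - N) * real (card E)) + N * B / (real CARD('a) - N)"
    (is "real (card ?T) \<le> _")
proof -
  let ?q = "real CARD('a)" and ?e = "real (card E)"
  let ?C = "cone_section m c :: ('a ^ 'n) set"
  define k where
    "k x = real (card {p\<in>E \<times> E. scalar_product (fst p) x = scalar_product (snd p) x})" for x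
  have e: "?e > 0"
    using assms(1) by (simp add: card_gt_0_iff)
  then have pos: "0 < ?e\<^sup>2 * (?q - N) / N"
    using N by (intro divide_pos_pos mult_pos_pos zero_less_power) auto
  have k: "?e\<^sup>2 \<le> real (card ((\<lambda>z. scalar_product z x) ` E)) * k x" for x
    unfolding k_def by (rule card_square_le_collisions) simp
  have k_le: "?e\<^sup>2 \<le> M * k x" if "real (card ((\<lambda>z. scalar_product z x) ` E)) \<le> M" for x M
    using k[of x] mult_right_mono[OF that, of "k x"] by (simp add: k_def)
  have "real (card ?T) * (?e\<^sup>2 * (?q - N) / N) = (\<Sum>x\<in>?T. ?e\<^sup>2 * (?q - N) / N)"
    by simp
  also have "\<dots> \<le> (\<Sum>x\<in>?T. ?q * k x - ?e\<^sup>2)"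
  proof (rule sum_mono)
    fix x assume "x \<in> ?T"
    then have "?e\<^sup>2 / N \<le> k x"
      using k_le N by (simp add: divide_le_eq mult.commute)
    then have "?q * (?e\<^sup>2 / N) \<le> ?q * k x"
      by (rule mult_left_mono) simp
    then show "?e\<^sup>2 * (?q - N) / N \<le> ?q * k x - ?e\<^sup>2"
      using N by (simp add: field_simps)
  qed
  also have "\<dots> \<le> (\<Sum>x\<in>?C. ?q * k x - ?e\<^sup>2)"
  \<comment> \<open>A scalar product takes at most q values, so \<open>k_le\<close> with
    \<open>M = q\<close> makes every excess nonnegative and the sum may be extended to the whole
    section.\<close>
  proof (rule sum_mono2)
    fix x
    show "0 \<le> ?q * k x - ?e\<^sup>2"
      using k_le[of x ?q] by (simp add: card_mono)
  qed auto
  also have "\<dots> = (\<Sum>p\<in>E \<times> E. discrepancy m c (fst p - snd p))"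
    unfolding k_def by (rule sum_collisions_eq_discrepancy)
  \<comment> \<open>Only the \<open>card E\<close> diagonal pairs have difference 0 and carry
    \<open>A\<close>; every pair carries \<open>B\<close>.\<close>
  also have "\<dots> \<le> (\<Sum>p\<in>E \<times> E. (if fst p = snd p then A else 0) + B)"
    using disc[of "fst p - snd p" for p] by (intro sum_mono) (simp add: right_minus_eq)
  also have "\<dots> = (\<Sum>z\<in>E. \<Sum>w\<in>E. if z = w then A else 0) + ?e\<^sup>2 * B"
    using sum.cartesian_product[of "\<lambda>z w. if z = w then A else 0" E E]
    by (simp only: sum.distrib case_prod_unfold sum_constant card_cartesian_product power2_eq_square of_nat_mult)
  also have "(\<Sum>z\<in>E. \<Sum>w\<in>E. if z = w then A else 0) = ?e * A"
    by simp
  finally have "real (card ?T) * (?e\<^sup>2 * (?q - N) / N) \<le> ?e * A + ?e\<^sup>2 * B" .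
  then have "real (card ?T) \<le> (?e * A + ?e\<^sup>2 * B) / (?e\<^sup>2 * (?q - N) / N)"
    using pos by (simp only: pos_le_divide_eq)
  also have "\<dots> = N * A / ((?q - N) * ?e) + N * B / (?q - N)"
  proof -
    have "(e * A + e\<^sup>2 * B) / (e\<^sup>2 * r / N) = N * A / (r * e) + N * B / r"
      if "e > 0" "r > 0" for e r
      using that N(1) by (simp add: power2_eq_square field_simps)
    from this[of ?e "?q - N"] e N(2) show ?thesis
      by simp
  qed
  finally show ?thesis .
qed

section \<open>From exceptional lines to points of the cone section\<close>

lemma card_projection_cosets_span:
  fixes x :: "'a::{field,finite} ^ 'n::finite"
  assumes "x \<noteq> 0"
  shows "card (projection_cosets (vec.span {x}) E) = card ((\<lambda>z. scalar_product z x) ` E)"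
proof -
  let ?V = "vec.span {x}"
  have perp: "perp ?V = {z. scalar_product z x = 0}"
  proof -
    have "scalar_product z (k *s x) = k * scalar_product z x" for z k
      by (simp add: scalar_product_def sum_distrib_left ac_simps)
    then show ?thesis
      by (auto simp: perp_def vec.span_singleton)
  qed
  \<comment> \<open>The cosets are the level sets of the scalar product with \<open>x\<close>, so
    those meeting \<open>E\<close> correspond to the values taken on \<open>E\<close>.\<close>
  have coset: "(+) z ` perp ?V = {y. scalar_product y x = scalar_product z x}" for z
  proof -
    have "y \<in> (+) z ` perp ?V \<longleftrightarrow> y - z \<in> perp ?V" for y
      by (auto simp: image_iff) (metis add_diff_cancel_left' diff_add_cancel add.commute)
    moreover have "scalar_product (y - z) x = scalar_product y x - scalar_product z x" for y
      by (simp add: scalar_product_def left_diff_distrib sum_subtractf)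
    ultimately show ?thesis
      by (auto simp: perp)
  qed
  have "projection_cosets ?V E = (\<lambda>v. {y. scalar_product y x = v}) ` (\<lambda>z. scalar_product z x) ` E"
    (is "_ = ?R")
  proof (intro equalityI subsetI)
    fix C assume "C \<in> projection_cosets ?V E"
    then obtain z w where "C = {y. scalar_product y x = scalar_product z x}" "w \<in> C" "w \<in> E"
      unfolding projection_cosets_def coset by blast
    then have "C = {y. scalar_product y x = scalar_product w x}"
      by auto
    with \<open>w \<in> E\<close> show "C \<in> ?R"
      by blast
  next
    fix C assume "C \<in> ?R"
    then obtain z where "C = {y. scalar_product y x = scalar_product z x}" "z \<in> E"
      by blast
    then show "C \<in> projection_cosets ?V E"
      unfolding projection_cosets_def coset by blast
  qed
  moreover have "inj_on (\<lambda>v. {y. scalar_product y x = v}) ((\<lambda>z. scalar_product z x) ` E)"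
    by (rule inj_onI) blast
  ultimately show ?thesis
    by (simp add: card_image)
qed

text \<open>A nonzero vector of a line spans it, and a unit vector with last coordinate
  \<open>c\<close> has its other coordinates on the cone. Covering the lines by these spans suffices
  for an upper bound.\<close>

lemma exceptional_lines_subset:
  fixes E :: "('a::{field,finite} ^ 'n::{finite,linorder}) set"
  assumes "c\<^sup>2 = 1"
  shows "exceptional_lines (lines_through_sphere_section (last_coord_plane c)) E N \<subseteq>
    (\<lambda>x. vec.span {x}) `
      {x\<in>cone_section (Max UNIV) c. real (card ((\<lambda>z. scalar_product z x) ` E)) \<le> N}"
proof
  fix V assume "V \<in> exceptional_lines (lines_through_sphere_section (last_coord_plane c)) E N"
  then obtain x where V: "vec.subspace V" "vec.dim V = 1"
    and x: "x \<in> V" "x \<noteq> 0" "x $ Max UNIV = c" "sq_norm x = 1"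
    and card: "real (card (projection_cosets V E)) \<le> N"
    by (auto simp: exceptional_lines_def lines_through_sphere_section_def last_coord_plane_def
        unit_sphere_def)
  have span: "V = vec.span {x}"
    using V x by (intro vec.subspace_dim_equal [symmetric]) (auto simp: vec.span_minimal)
  have "sq_norm x = c\<^sup>2 + (\<Sum>i\<in>UNIV-{Max UNIV}. (x $ i)\<^sup>2)"
    using x(3) by (simp add: sq_norm_def sum.remove[of UNIV "Max UNIV"])
  then have "x \<in> cone_section (Max UNIV) c"
    using x assms by (simp add: cone_section_def)
  moreover have "real (card ((\<lambda>z. scalar_product z x) ` E)) \<le> N"
    using card card_projection_cosets_span[OF x(2)] by (simp add: span)
  ultimately show "V \<in> (\<lambda>x. vec.span {x}) `
      {x\<in>cone_section (Max UNIV) c. real (card ((\<lambda>z. scalar_product z x) ` E)) \<le> N}"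
    using span by blast
qed

theorem theorem1p4:
  fixes E :: "('a::{field,finite} ^ 'n::{finite,linorder}) set"
    and c :: 'a and N :: real and q d :: nat
  assumes q: "q = CARD('a)" "odd q"
    and d: "d = CARD('n)" "d \<ge> 3"
    and E: "E \<noteq> {}"
    and c: "c \<in> {1, - 1}"
    and N: "0 < N" "N < real q"
  shows "real (card (exceptional_lines (lines_through_sphere_section (last_coord_plane c)) E N)) \<le>
    (if d \<ge> 4 \<and> even d then
       N * real q ^ (d - 1) / ((real q - N) * real (card E))
         + N * real q ^ (d div 2) / (real q - N)
     else if d mod 4 = 3 \<and> q mod 4 = 3 then
       N * real q ^ (d - 1) / ((real q - N) * real (card E))
         + N * real q ^ ((d - 1) div 2) / (real q - N)
     else
       N * real q ^ (d - 1) / ((real q - N) * real (card E))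
         + N * real q ^ ((d + 1) div 2) / (real q - N))"
proof -
  let ?m = "Max UNIV :: 'n"
  have two: "(2::'a) \<noteq> 0"
    using q even_card_of_char_two[where ?'a = 'a] by blast
  obtain \<psi> :: "'a \<Rightarrow> complex" where "additive_character \<psi>"
    using additive_character_exists two by (metis additive_character_def)
  then interpret additive_character \<psi> .
  have "c \<noteq> 0" "c\<^sup>2 = 1"
    using c by auto
  have n: "card (UNIV - {?m}) = d - 1"
    using d by simp
  define B where "B = (if odd (d - 1) then real q ^ ((d - 1 + 1) div 2)
     else if (d - 1) mod 4 = 2 \<and> q mod 4 = 3 then real q ^ ((d - 1) div 2)
     else real q ^ ((d - 1) div 2 + 1))"
  let ?T = "{x\<in>cone_section ?m c. real (card ((\<lambda>z. scalar_product z x) ` E)) \<le> N}"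
  have "card (exceptional_lines (lines_through_sphere_section (last_coord_plane c)) E N) \<le> card ?T"
    by (rule surj_card_le[OF _ exceptional_lines_subset[OF \<open>c\<^sup>2 = 1\<close>]]) simp
  moreover have "real (card ?T) \<le>
      N * real q ^ (d - 1) / ((real q - N) * real (card E)) + N * B / (real q - N)"
    using discrepancy_le[OF \<open>c \<noteq> 0\<close>, of ?m] unfolding n B_def q(1)
    by (intro card_few_values_le E) (use N q in auto)
  moreover have "B = (if d \<ge> 4 \<and> even d then real q ^ (d div 2)
     else if d mod 4 = 3 \<and> q mod 4 = 3 then real q ^ ((d - 1) div 2) else real q ^ ((d + 1) div 2))"
  proof -
    obtain k where k: "d = k + 3"
      using d(2) by (metis add.commute le_Suc_ex)
    \<comment> \<open>With n = d - 1, odd n means even d (then at least 4), and n congruent to 2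
      modulo 4 means d congruent to 3; these match the cases of the discrepancy bound with those of
      the theorem.\<close>
    have "odd k \<Longrightarrow> k \<ge> 1" "(k + 2) mod 4 = 2 \<longleftrightarrow> (k + 3) mod 4 = 3"
      by presburger+
    then have eqs: "d - 1 + 1 = d" "odd (d - 1) \<longleftrightarrow> d \<ge> 4 \<and> even d" "(d - 1) mod 4 = 2 \<longleftrightarrow> d mod 4 = 3"
      "(d - 1) div 2 + 1 = (d + 1) div 2"
      unfolding k by auto
    show ?thesis
      unfolding B_def eqs ..
  qed
  ultimately show ?thesis
    by (auto split: if_splits)
qed

end
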